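(* For every integer $k\ge 1$, the quantity $$\frac{n!\,k!\,(n+k+1)!}{(2n+2)!}\,F(2n+2k;\,0,\,n),$$ as a function of the integer $n\ge 0$, is given by a polynomial in $n$ with all coefficients integers and with leading term $2^{3k-2}n^{2k-2}$.
   Context: For integers $m\ge 0$ and $n_1,n_2$, $F(m;n_1,n_2)$ denotes the number of Gessel walks with exactly $m$ steps from $(0,0)$ to $(n_1,n_2)$: lattice walks starting at the origin, each of whose $m$ steps is one of West $(-1,0)$, North-East $(1,1)$, East $(1,0)$, South-West $(-1,-1)$, and which remain in the first quadrant $\{(i,j): i\ge 0, j\ge 0\}$. In particular $F(m;n_1,n_2)=0$ if $n_1<0$ or $n_2<0$, and $F(0;n_1,n_2)=1$ if $n_1=n_2=0$ and $0$ otherwise. *)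

theory Defs
  imports "HOL-Computational_Algebra.Polynomial" "HOL-Library.Product_Plus"
begin

definition gessel_steps :: "(int \<times> int) set" where
  "gessel_steps = {(-1, 0), (1, 1), (1, 0), (-1, -1)}"

definition quadrant :: "(int \<times> int) set" where
  "quadrant = {(i, j). i \<ge> 0 \<and> j \<ge> 0}"

text \<open>A walk is the list of its steps; after \<open>j\<close> steps it stands at \<open>sum_list (take j w)\<close>,
  with componentwise addition on pairs.\<close>

definition gessel_walks :: "nat \<Rightarrow> int \<Rightarrow> int \<Rightarrow> (int \<times> int) list set" where
  "gessel_walks m n1 n2 =
    {w. length w = m \<and> set w \<subseteq> gessel_steps \<and>
        (\<forall>j\<le>m. sum_list (take j w) \<in> quadrant) \<and>
        sum_list w = (n1, n2)}"

definition F :: "nat \<Rightarrow> int \<Rightarrow> int \<Rightarrow> nat" where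
  "F m n1 n2 = card (gessel_walks m n1 n2)"

end

theory Submission imports Defs begin

text \<open>Decompose by first passage: a quadrant walk to \<open>(0, n)\<close> is a walk in the half-plane
  \<open>x \<ge> 0\<close> that never leaves the quadrant, and a half-plane walk that does leave it follows a
  quadrant walk ending on the \<open>x\<close>-axis by a \<open>SW\<close> step and an arbitrary half-plane walk. Half-plane
  walks are counted by a ballot number times a binomial coefficient. With \<open>k\<close> fixed, only finitely
  many initial quadrant walks contribute, independently of \<open>n\<close>, and every term becomes an integer
  polynomial in \<open>N = n + 1\<close> after multiplication by \<open>N! k! (n + k + 1)! / (2N)!\<close>. The extra
  factor \<open>N\<close> divides their sum, because the decomposition persists at \<open>n = -1\<close>, where there are
  no quadrant walks.\<close>

subsection \<open>Quadrant walks by number of steps\<close>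

definition quadrant_walks :: "nat \<Rightarrow> (int \<times> int) list set" where
  "quadrant_walks m = {w. length w = m \<and> set w \<subseteq> gessel_steps \<and>
     (\<forall>j\<le>m. sum_list (take j w) \<in> quadrant)}"

lemma gessel_walks_eq: "gessel_walks m n1 n2 = {w \<in> quadrant_walks m. sum_list w = (n1, n2)}"
  by (auto simp: gessel_walks_def quadrant_walks_def)

lemma finite_quadrant_walks: "finite (quadrant_walks m)"
proof -
  have "finite {w. set w \<subseteq> gessel_steps \<and> length w = m}"
    by (rule finite_lists_length_eq) (simp add: gessel_steps_def)
  then show ?thesis
    by (rule finite_subset[rotated]) (auto simp: quadrant_walks_def)
qed

lemma quadrant_walks_0: "quadrant_walks 0 = {[]}"
  by (auto simp: quadrant_walks_def quadrant_def zero_prod_def)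

lemma quadrant_walks_end: "w \<in> quadrant_walks m \<Longrightarrow> sum_list w \<in> quadrant"
  by (auto simp: quadrant_walks_def)

lemma snoc_in_quadrant_walks:
  "w @ [s] \<in> quadrant_walks (Suc m) \<longleftrightarrow>
     w \<in> quadrant_walks m \<and> s \<in> gessel_steps \<and> sum_list w + s \<in> quadrant"
  by (auto simp: quadrant_walks_def le_Suc_eq all_conj_distrib)

lemma sum_quadrant_walks_Suc:
  fixes f :: "(int \<times> int) list \<Rightarrow> 'a :: comm_monoid_add"
  shows "sum f (quadrant_walks (Suc m)) =
    (\<Sum>w\<in>quadrant_walks m. \<Sum>s\<in>gessel_steps. if sum_list w + s \<in> quadrant then f (w @ [s]) else 0)"
proof -
  let ?A = "SIGMA w:quadrant_walks m. {s \<in> gessel_steps. sum_list w + s \<in> quadrant}"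
  have fin: "finite gessel_steps"
    by (simp add: gessel_steps_def)
  have "quadrant_walks (Suc m) = (\<lambda>(w, s). w @ [s]) ` ?A"
  proof (intro equalityI subsetI)
    fix v assume v: "v \<in> quadrant_walks (Suc m)"
    then have "v \<noteq> []"
      by (auto simp: quadrant_walks_def)
    then obtain w s where "v = w @ [s]"
      by (metis rev_exhaust)
    with v show "v \<in> (\<lambda>(w, s). w @ [s]) ` ?A"
      by (auto simp: snoc_in_quadrant_walks image_iff)
  qed (auto simp: snoc_in_quadrant_walks)
  moreover have "inj_on (\<lambda>(w, s). w @ [s]) ?A"
    by (auto simp: inj_on_def)
  ultimately have "sum f (quadrant_walks (Suc m)) = (\<Sum>(w, s)\<in>?A. f (w @ [s]))"
    by (simp add: sum.reindex o_def case_prod_unfold)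
  also have "\<dots> = (\<Sum>w\<in>quadrant_walks m. \<Sum>s\<in>{s \<in> gessel_steps. sum_list w + s \<in> quadrant}. f (w @ [s]))"
    using fin by (subst sum.Sigma) (auto simp: finite_quadrant_walks)
  finally show ?thesis
    using fin by (simp add: sum.inter_filter)
qed

text \<open>Counts the steps E and NE; together with the length this determines the
  x-coordinate.\<close>

definition ups :: "(int \<times> int) list \<Rightarrow> nat" where
  "ups w = length (filter (\<lambda>s. fst s = 1) w)"

lemma ups_snoc: "ups (w @ [s]) = (if fst s = 1 then Suc (ups w) else ups w)"
  by (simp add: ups_def)

lemma ups_le_length: "ups w \<le> length w"
  by (simp add: ups_def)

lemma fst_sum_list_steps:
  "set w \<subseteq> gessel_steps \<Longrightarrow> fst (sum_list w) = 2 * int (ups w) - int (length w)"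
  by (induction w) (auto simp: ups_def gessel_steps_def zero_prod_def)

lemma fst_quadrant_walk:
  "w \<in> quadrant_walks m \<Longrightarrow> fst (sum_list w) = 2 * int (ups w) - int m"
  using fst_sum_list_steps by (auto simp: quadrant_walks_def)

subsection \<open>Walks in the half-plane\<close>

text \<open>Extension by 0 to negative lower index makes Pascal's rule hold for every integer
  \<open>z\<close>, so the recurrences need no boundary cases.\<close>

definition ibinom :: "nat \<Rightarrow> int \<Rightarrow> int" where
  "ibinom L z = (if z < 0 then 0 else int (L choose nat z))"

lemma ibinom_Suc: "ibinom (Suc L) z = ibinom L z + ibinom L (z - 1)"
proof (cases "z \<le> 0")
  case True
  then show ?thesis by (auto simp: ibinom_def)
next
  case False
  then obtain j where "z = int (Suc j)"
    by (metis not_le zero_less_imp_eq_int gr0_conv_Suc)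
  then show ?thesis
    by (simp add: ibinom_def nat_add_distrib)
qed

lemma ibinom_0: "ibinom 0 z = (if z = 0 then 1 else 0)"
  by (auto simp: ibinom_def)

text \<open>The two middle entries of an odd row agree: this makes the ballot number vanish at the
  starting point \<open>x = L - 2 * U = -1\<close>.\<close>

lemma ibinom_odd_middle:
  assumes "int L = 2 * U - 1"
  shows "ibinom L (U - 1) = ibinom L U"
proof -
  from assms have "U > 0"
    by linarith
  then obtain u where u: "U = int (Suc u)"
    by (metis zero_less_imp_eq_int gr0_conv_Suc)
  with assms have "L = 2 * u + 1" by simp
  with u show ?thesis
    using central_binomial_odd[of L] by (simp add: ibinom_def nat_add_distrib)
qed

text \<open>The number of walks of length \<open>L\<close> in the half-plane \<open>x \<ge> 0\<close> that end on \<open>x = 0\<close> and make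
  \<open>U\<close> more steps to the right; the first factor is the ballot number of the projection to the
  \<open>x\<close>-axis (by reflection, so meaningful only for starting points \<open>x = L - 2 * U \<ge> -1\<close>). Each projected step lifts to two steps; the second factor counts the lifts, \<open>e\<close> being
  the number of \<open>E\<close> and \<open>SW\<close> steps.\<close>

definition halfplane :: "nat \<Rightarrow> int \<Rightarrow> int \<Rightarrow> int" where
  "halfplane L U e = (ibinom L U - ibinom L (U - 1)) * ibinom L e"

text \<open>Pascal's rule in both factors; the four terms belong to the first steps E, NE, W and SW,
  in this order.\<close>

lemma halfplane_Suc:
  "halfplane (Suc L) U e = halfplane L (U - 1) (e - 1) + halfplane L (U - 1) e
     + halfplane L U e + halfplane L U (e - 1)"
  by (simp add: halfplane_def ibinom_Suc algebra_simps)

section \<open>First-passage decomposition\<close>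

text \<open>For \<open>w\<close> of length \<open>2 * M - L\<close>, the half-plane walks of
  \<open>L\<close> steps from its end to \<open>(0, M - k)\<close>. They make
  \<open>U = M - ups w\<close> right steps and change \<open>y\<close> by \<open>U - e\<close>,
  which gives the last argument.\<close>

definition continuations :: "nat \<Rightarrow> nat \<Rightarrow> nat \<Rightarrow> (int \<times> int) list \<Rightarrow> int" where
  "continuations M k L w =
     halfplane L (int M - int (ups w)) (snd (sum_list w) + int k - int (ups w))"

lemma continuations_Suc:
  "continuations M k (Suc L) w = (\<Sum>s\<in>gessel_steps. continuations M k L (w @ [s]))"
  by (simp add: continuations_def halfplane_Suc gessel_steps_def ups_snoc algebra_simps)

text \<open>A one-step extension of a quadrant walk leaves the quadrant either to the left, where the
  ballot number vanishes, or by a \<open>SW\<close> step from the \<open>x\<close>-axis.\<close>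

lemma sum_continuations_step:
  assumes t: "t < 2 * M"
  shows "(\<Sum>w\<in>quadrant_walks t. continuations M k (2 * M - t) w) =
    (\<Sum>w\<in>quadrant_walks (Suc t). continuations M k (2 * M - Suc t) w) +
    (\<Sum>w\<in>{w \<in> quadrant_walks t. snd (sum_list w) = 0 \<and> fst (sum_list w) > 0}.
       halfplane (2 * M - Suc t) (int M - int (ups w)) (int k - int (ups w) - 1))"
proof -
  let ?L = "2 * M - Suc t"
  let ?h = "\<lambda>w. halfplane ?L (int M - int (ups w)) (int k - int (ups w) - 1)"
  have L: "2 * M - t = Suc ?L"
    using t by simp
  have step: "continuations M k (Suc ?L) w =
      (\<Sum>s\<in>gessel_steps. if sum_list w + s \<in> quadrant then continuations M k ?L (w @ [s]) else 0)
      + (if snd (sum_list w) = 0 \<and> fst (sum_list w) > 0 then ?h w else 0)"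
    if w: "w \<in> quadrant_walks t" for w
  proof -
    obtain i j where ij: "sum_list w = (i, j)"
      by fastforce
    have i: "i = 2 * int (ups w) - int t"
      using fst_quadrant_walk[OF w] ij by simp
    have nonneg: "i \<ge> 0" "j \<ge> 0"
      using quadrant_walks_end[OF w] ij by (auto simp: quadrant_def)
    have left: "halfplane ?L (int M - int (ups w)) e = 0" if "i = 0" for e
      using that i t unfolding halfplane_def by (subst ibinom_odd_middle) auto
    show ?thesis
      unfolding continuations_Suc using nonneg left
      by (auto simp: gessel_steps_def quadrant_def ij continuations_def ups_snoc algebra_simps)
  qed
  show ?thesis
    unfolding L sum_quadrant_walks_Suc
    by (simp add: step sum.distrib finite_quadrant_walks flip: sum.inter_filter)
qed

lemma sum_continuations_end:
  "(\<Sum>w\<in>quadrant_walks (2 * M). continuations M k 0 w) = int (F (2 * M) 0 (int M - int k))"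
proof -
  have "continuations M k 0 w = (if sum_list w = (0, int M - int k) then 1 else 0)"
    if w: "w \<in> quadrant_walks (2 * M)" for w
  proof -
    obtain i j where ij: "sum_list w = (i, j)"
      by fastforce
    \<comment> \<open>\<open>halfplane 0 U 0\<close> is 1 at \<open>U = 0\<close> but -1 at
      \<open>U = 1\<close>; here \<open>U = M - ups w\<close>, and \<open>i \<ge> 0\<close> forces
      \<open>U \<le> 0\<close>.\<close>
    have "i = 2 * int (ups w) - 2 * int M" "i \<ge> 0"
      using fst_quadrant_walk[OF w] quadrant_walks_end[OF w] ij by (auto simp: quadrant_def)
    then show ?thesis
      by (auto simp: continuations_def halfplane_def ibinom_0 ij)
  qed
  then show ?thesis
    by (simp add: F_def gessel_walks_eq finite_quadrant_walks flip: sum.inter_filter)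
qed

text \<open>Walks that a SW step takes out through the x-axis; from the corner that step counts as
  leaving to the left, hence \<open>x > 0\<close>. With \<open>k = K + 1\<close>, the bound on
  \<open>ups w\<close> keeps the remaining \<open>e = K - ups w\<close> nonnegative.\<close>

definition exits :: "nat \<Rightarrow> nat \<Rightarrow> (int \<times> int) list set" where
  "exits K t = {w \<in> quadrant_walks t. snd (sum_list w) = 0 \<and> fst (sum_list w) > 0 \<and> ups w \<le> K}"

lemma finite_exits: "finite (exits K t)"
  by (simp add: exits_def finite_quadrant_walks)

lemma exits_ups:
  assumes "w \<in> exits K t"
  shows "ups w \<le> K" "t < 2 * ups w" "ups w \<le> t"
  using assms fst_quadrant_walk[of w t] ups_le_length[of w]
  by (auto simp: exits_def quadrant_walks_def)

lemma F_first_passage: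
  assumes "K \<le> M"
  shows "int (F (2 * M) 0 (int M - int (Suc K))) =
    halfplane (2 * M) (int M) (int (Suc K)) -
    (\<Sum>t<2 * K. \<Sum>w\<in>exits K t.
       halfplane (2 * M - Suc t) (int M - int (ups w)) (int (K - ups w)))"
proof -
  let ?S = "\<lambda>t. \<Sum>w\<in>quadrant_walks t. continuations M (Suc K) (2 * M - t) w"
  let ?E = "\<lambda>t. {w \<in> quadrant_walks t. snd (sum_list w) = 0 \<and> fst (sum_list w) > 0}"
  let ?h = "\<lambda>t w. halfplane (2 * M - Suc t) (int M - int (ups w)) (int (Suc K) - int (ups w) - 1)"
  \<comment> \<open>The one-step identity telescopes from all half-plane walks at time 0 to the
    quadrant walks at time \<open>2 * M\<close>.\<close>
  have "?S 0 = ?S m + (\<Sum>t<m. sum (?h t) (?E t))" if "m \<le> 2 * M" for m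
    using that by (induction m) (use sum_continuations_step[of _ M "Suc K"] in auto)
  from this[of "2 * M"]
  have "?S 0 = int (F (2 * M) 0 (int M - int (Suc K))) + (\<Sum>t<2 * M. sum (?h t) (?E t))"
    using sum_continuations_end[of M "Suc K"] by simp
  moreover have "?S 0 = halfplane (2 * M) (int M) (int (Suc K))"
    by (simp add: quadrant_walks_0 continuations_def ups_def)
  moreover have exits: "sum (?h t) (?E t) =
      (\<Sum>w\<in>exits K t. halfplane (2 * M - Suc t) (int M - int (ups w)) (int (K - ups w)))" for t
  proof -
    \<comment> \<open>More than \<open>K\<close> right steps make the last argument of
      \<open>halfplane\<close> negative, so the term is 0.\<close>
    have "sum (?h t) (?E t) = sum (?h t) (exits K t)"
      by (rule sum.mono_neutral_right)
        (auto simp: finite_quadrant_walks exits_def halfplane_def ibinom_def)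
    then show ?thesis
      by (simp add: exits_ups(1) of_nat_diff)
  qed
  moreover have "(\<Sum>t<2 * M. sum (?h t) (?E t)) = (\<Sum>t<2 * K. sum (?h t) (?E t))"
  proof (rule sum.mono_neutral_right)
    show "\<forall>t\<in>{..<2 * M} - {..<2 * K}. sum (?h t) (?E t) = 0"
    proof
      fix t assume "t \<in> {..<2 * M} - {..<2 * K}"
      \<comment> \<open>An exit has \<open>x = 2 * ups w - t > 0\<close>, so
        \<open>t < 2 * K\<close>: the range of summation does not depend on
        \<open>M\<close>.\<close>
      then have "exits K t = {}"
        using exits_ups[of _ K t] by fastforce
      then show "sum (?h t) (?E t) = 0"
        unfolding exits by simp
    qed
  qed (use assms in auto)
  ultimately show ?thesis
    by simp
qed

subsection \<open>The counts as polynomials\<close>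

text \<open>Closed form of the ballot number with denominators cleared; \<open>D\<close> is the
  number of left steps.\<close>

lemma ballot_fact:
  assumes L: "L = U + D"
  shows "(ibinom L (int U) - ibinom L (int U - 1)) * fact U * fact (D + 1)
     = (int D + 1 - int U) * fact L"
proof (cases U)
  case 0
  with L show ?thesis by (simp add: ibinom_def)
next
  case (Suc u)
  have c1: "fact U * fact D * int (U + D choose U) = fact (U + D)"
    using arg_cong[OF binomial_fact_lemma[of U "U + D"], of int] by simp
  have c2: "fact u * fact (Suc D) * int (U + D choose u) = fact (U + D)"
    using arg_cong[OF binomial_fact_lemma[of u "U + D"], of int] Suc
    by (simp del: fact_Suc)
  have "(ibinom L (int U) - ibinom L (int U - 1)) * fact U * fact (D + 1)
      = (int D + 1) * (fact U * fact D * int (U + D choose U))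
        - int U * (fact u * fact (Suc D) * int (U + D choose u))"
    using Suc L by (simp add: ibinom_def nat_add_distrib algebra_simps)
  then show ?thesis
    unfolding c1 c2 L by (simp add: algebra_simps)
qed

lemma ibinom_fact: "ibinom L (int r) * fact r = (\<Prod>i<r. int L - int i)"
proof (induction r)
  case (Suc r)
  have "int (L choose Suc r) * (int r + 1) = int (L choose r) * (int L - int r)"
  proof (cases "r \<le> L")
    case True
    have "Suc r * (L choose Suc r) = (L - r) * (L choose r)"
      by (simp only: binomial_absorption binomial_absorb_comp)
    from arg_cong[OF this, of int] True show ?thesis
      by (simp only: of_nat_mult of_nat_diff of_nat_Suc mult_ac add_ac)
  qed (simp add: binomial_eq_0)
  then have "ibinom L (int (Suc r)) * fact (Suc r) = ibinom L (int r) * fact r * (int L - int r)"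
    by (simp add: ibinom_def nat_add_distrib algebra_simps flip: distrib_left)
  with Suc show ?case
    by simp
qed (simp add: ibinom_def)

lemma fact_add_eq: "fact (a + d) = (fact a * (\<Prod>i<d. int a + 1 + int i) :: int)"
  by (induction d) (auto simp: algebra_simps)

text \<open>The even factors of \<open>(2 * (N + r))! / (2 * N)!\<close> give
  \<open>2 ^ r * (N + r)! / N!\<close>; the odd ones stay as a product.\<close>

lemma fact_double_add:
  "fact N * fact (2 * (N + r)) =
     (fact (2 * N) * fact (N + r) * 2 ^ r * (\<Prod>i<r. 2 * int N + 2 * int i + 1) :: int)"
proof (induction r)
  case (Suc r)
  have "fact N * fact (2 * (N + Suc r)) =
      (2 * int (N + r) + 2) * (2 * int (N + r) + 1) * (fact N * fact (2 * (N + r)) :: int)"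
    by (simp add: algebra_simps)
  then show ?case
    unfolding Suc by (simp add: algebra_simps)
qed simp

definition main_poly :: "nat \<Rightarrow> int poly" where
  "main_poly K = smult (2 ^ K) ((\<Prod>i<K. [:2 * int i + 1, 2:]) * (\<Prod>i<Suc K. [:2 * int K - int i, 2:]))"

text \<open>From the origin the ballot number is the Catalan number
  \<open>(2 * M)! / (M! * (M + 1)!)\<close> with \<open>M = N + K\<close>, so the factor
  \<open>(N + K + 1)!\<close> cancels exactly.\<close>

lemma main_poly_eval:
  "fact N * fact (Suc K) * fact (N + K + 1) * halfplane (2 * (N + K)) (int (N + K)) (int (Suc K))
     = fact (2 * N) * poly (main_poly K) (int N)"
proof -
  let ?M = "N + K"
  have b: "(ibinom (2 * ?M) (int ?M) - ibinom (2 * ?M) (int ?M - 1)) * fact ?M * fact (?M + 1)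
      = fact (2 * ?M)"
    using ballot_fact[of "2 * ?M" ?M ?M] by simp
  have c: "ibinom (2 * ?M) (int (Suc K)) * fact (Suc K) = (\<Prod>i<Suc K. 2 * int N + 2 * int K - int i)"
    using ibinom_fact[of "2 * ?M" "Suc K"] by (simp del: fact_Suc)
  have "(fact N * fact (Suc K) * fact (?M + 1) * halfplane (2 * ?M) (int ?M) (int (Suc K))) * fact ?M
      = fact N * ((ibinom (2 * ?M) (int ?M) - ibinom (2 * ?M) (int ?M - 1)) * fact ?M * fact (?M + 1))
        * (ibinom (2 * ?M) (int (Suc K)) * fact (Suc K))"
    by (simp only: halfplane_def mult_ac)
  also have "\<dots> = fact N * fact (2 * ?M) * (\<Prod>i<Suc K. 2 * int N + 2 * int K - int i)"
    by (simp only: b c)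
  also have "\<dots> = (fact (2 * N) * poly (main_poly K) (int N)) * fact ?M"
    unfolding fact_double_add by (simp add: main_poly_def poly_prod algebra_simps)
  finally show ?thesis
    by simp
qed

text \<open>For a walk with \<open>p\<close> steps to the right and \<open>q\<close> to the left, \<open>r = K - p\<close> and
  \<open>e = p - q - 1\<close>, where \<open>K = k - 1\<close>.\<close>

definition exit_poly :: "nat \<Rightarrow> nat \<Rightarrow> nat \<Rightarrow> int poly" where
  "exit_poly r e q = smult (fact (r + e + q + 2) div fact r * (int e + 1) * 2 ^ r)
     ((\<Prod>i<r. [:2 * int i + 1, 2:]) * (\<Prod>i<e. [:2 * int r + 1 + int i, 2:]) *
      (\<Prod>i<Suc q. [:int r + int e + 2 + int i, 1:]) * (\<Prod>i<r. [:2 * int r + int e - int i, 2:]))"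

text \<open>The continuation has \<open>N + r\<close> right and \<open>N + r + e\<close> left steps,
  so its ballot numerator is \<open>e + 1\<close>, and \<open>(N + K + 1)!\<close> exceeds its
  denominator \<open>(N + r + e + 1)!\<close> by \<open>q + 1\<close> linear factors.\<close>

lemma exit_poly_eval:
  assumes K: "K = r + e + q + 1" and L: "L = 2 * (N + r) + e"
  shows "fact N * fact (Suc K) * fact (N + K + 1) * halfplane L (int (N + r)) (int r)
     = fact (2 * N) * poly (exit_poly r e q) (int N)"
proof -
  let ?U = "N + r"
  let ?b = "ibinom L (int ?U) - ibinom L (int ?U - 1)"
  let ?A = "\<Prod>i<r. 2 * int N + 2 * int i + 1"
  let ?B = "\<Prod>i<e. 2 * int ?U + 1 + int i"
  let ?C = "\<Prod>i<Suc q. int (?U + e + 1) + 1 + int i"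
  let ?D = "\<Prod>i<r. int L - int i"
  have b: "?b * fact ?U * fact (?U + e + 1) = (int e + 1) * fact L"
    using ballot_fact[of L ?U "?U + e"] L by (simp del: fact_Suc)
  have c: "ibinom L (int r) * fact r = ?D"
    by (rule ibinom_fact)
  have NL: "fact N * fact L = fact (2 * N) * fact ?U * 2 ^ r * ?A * ?B"
    using fact_double_add[of N r] fact_add_eq[of "2 * ?U" e] by (simp add: L algebra_simps)
  have d: "fact (N + K + 1) = fact (?U + e + 1) * ?C"
    using fact_add_eq[of "?U + e + 1" "Suc q"] by (simp add: K add_ac del: fact_Suc)
  \<comment> \<open>The factor \<open>k!\<close> absorbs the denominator \<open>r!\<close> of the
    second binomial, which keeps the coefficients integral.\<close>
  have k: "fact (Suc K) = fact (r + e + q + 2) div fact r * (fact r :: int)"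
    by (simp add: K fact_dvd del: fact_Suc)
  let ?c = "fact (r + e + q + 2) div fact r :: int"
  have "(fact N * fact (Suc K) * fact (N + K + 1) * halfplane L (int ?U) (int r)) * fact ?U
      = fact N * ?c * ?C * (?b * fact ?U * fact (?U + e + 1)) * (ibinom L (int r) * fact r)"
    unfolding halfplane_def d k by (simp only: mult_ac)
  also have "\<dots> = ?c * ?C * (int e + 1) * (fact N * fact L) * ?D"
    unfolding b c by (simp only: mult_ac)
  also have "\<dots> = (fact (2 * N) * (?c * (int e + 1) * 2 ^ r * (?A * ?B * ?C * ?D))) * fact ?U"
    unfolding NL by (simp only: mult_ac)
  also have "?c * (int e + 1) * 2 ^ r * (?A * ?B * ?C * ?D) = poly (exit_poly r e q) (int N)"
    by (simp add: exit_poly_def poly_prod L algebra_simps)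
  finally show ?thesis
    by simp
qed

section \<open>Degrees and leading coefficients\<close>

lemma degree_prod_linear:
  assumes "\<And>i. c i \<noteq> 0"
  shows "degree (\<Prod>i<m. [:a i, c i :: int:]) = m"
    and "lead_coeff (\<Prod>i<m. [:a i, c i:]) = (\<Prod>i<m. c i)"
proof -
  show "degree (\<Prod>i<m. [:a i, c i :: int:]) = m"
    using assms by (simp add: degree_prod_eq_sum_degree)
  show "lead_coeff (\<Prod>i<m. [:a i, c i:]) = (\<Prod>i<m. c i)"
    unfolding lead_coeff_prod using assms by simp
qed

lemma degree_main_poly: "degree (main_poly K) = 2 * K + 1"
  and lead_coeff_main_poly: "lead_coeff (main_poly K) = 2 ^ (3 * K + 1)"
proof -
  let ?A = "\<Prod>i<K. [:2 * int i + 1, 2:]" and ?B = "\<Prod>i<Suc K. [:2 * int K - int i, 2:]"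
  have "degree ?A = K" "degree ?B = Suc K"
    by (rule degree_prod_linear, simp)+
  moreover have "?A \<noteq> 0" "?B \<noteq> 0"
    by (simp_all del: prod.lessThan_Suc)
  ultimately show "degree (main_poly K) = 2 * K + 1"
    by (simp add: main_poly_def degree_mult_eq del: prod.lessThan_Suc)
  have "lead_coeff ?A = 2 ^ K" "lead_coeff ?B = 2 ^ Suc K"
    by (subst degree_prod_linear(2); simp)+
  then have "lead_coeff (main_poly K) = 2 ^ K * (2 ^ K * 2 ^ Suc K)"
    by (simp only: main_poly_def lead_coeff_smult lead_coeff_mult)
  also have "\<dots> = 2 ^ (3 * K + 1)"
    by (simp flip: power_add)
  finally show "lead_coeff (main_poly K) = 2 ^ (3 * K + 1)" .
qed

text \<open>In terms of \<open>p\<close> and \<open>K\<close> the bound is \<open>2 * K - p\<close>,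
  below the degree of \<open>main_poly K\<close>, so exits do not affect the leading term.\<close>

lemma degree_exit_poly_le: "degree (exit_poly r e q) \<le> 2 * r + e + q + 1"
proof -
  have "degree (exit_poly r e q) \<le> r + e + Suc q + r"
    unfolding exit_poly_def
    by (intro order_trans[OF degree_smult_le] order_trans[OF degree_mult_le] add_mono)
       (simp_all only: degree_prod_linear)
  then show ?thesis
    by simp
qed

section \<open>The polynomial of the full count and its root at 0\<close>

definition count_poly :: "nat \<Rightarrow> int poly" where
  "count_poly K = main_poly K -
     (\<Sum>t<2 * K. \<Sum>w\<in>exits K t. exit_poly (K - ups w) (2 * ups w - t - 1) (t - ups w))"

lemma count_poly_eval:
  "fact N * fact (Suc K) * fact (N + K + 1) * int (F (2 * (N + K)) 0 (int N - 1))
     = fact (2 * N) * poly (count_poly K) (int N)"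
proof -
  let ?c = "fact N * fact (Suc K) * fact (N + K + 1) :: int"
  have exit: "?c * halfplane (2 * (N + K) - Suc t) (int (N + K) - int (ups w)) (int (K - ups w))
      = fact (2 * N) * poly (exit_poly (K - ups w) (2 * ups w - t - 1) (t - ups w)) (int N)"
    if w: "w \<in> exits K t" for w t
  proof -
    have "int (N + K) - int (ups w) = int (N + (K - ups w))"
      using exits_ups[OF w] by simp
    then show ?thesis
      using exits_ups[OF w] by (simp only:) (rule exit_poly_eval; simp)
  qed
  have "int (F (2 * (N + K)) 0 (int N - 1)) = halfplane (2 * (N + K)) (int (N + K)) (int (Suc K)) -
      (\<Sum>t<2 * K. \<Sum>w\<in>exits K t.
         halfplane (2 * (N + K) - Suc t) (int (N + K) - int (ups w)) (int (K - ups w)))"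
    using F_first_passage[of K "N + K"] by simp
  then have "?c * int (F (2 * (N + K)) 0 (int N - 1)) =
      ?c * halfplane (2 * (N + K)) (int (N + K)) (int (Suc K)) -
      (\<Sum>t<2 * K. \<Sum>w\<in>exits K t.
         ?c * halfplane (2 * (N + K) - Suc t) (int (N + K) - int (ups w)) (int (K - ups w)))"
    by (simp only: right_diff_distrib sum_distrib_left)
  also have "\<dots> = fact (2 * N) * poly (main_poly K) (int N) -
      (\<Sum>t<2 * K. \<Sum>w\<in>exits K t.
        fact (2 * N) * poly (exit_poly (K - ups w) (2 * ups w - t - 1) (t - ups w)) (int N))"
    by (simp only: main_poly_eval exit cong: sum.cong)
  also have "\<dots> = fact (2 * N) * poly (count_poly K) (int N)"
    by (simp only: count_poly_def poly_diff poly_sum right_diff_distrib sum_distrib_left)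
  finally show ?thesis .
qed

lemma degree_count_poly: "degree (count_poly K) = 2 * K + 1"
  and lead_coeff_count_poly: "lead_coeff (count_poly K) = 2 ^ (3 * K + 1)"
proof -
  let ?s = "\<Sum>t<2 * K. \<Sum>w\<in>exits K t. exit_poly (K - ups w) (2 * ups w - t - 1) (t - ups w)"
  have "degree (exit_poly (K - ups w) (2 * ups w - t - 1) (t - ups w)) \<le> 2 * K"
    if "w \<in> exits K t" for w t
    using degree_exit_poly_le[of "K - ups w" "2 * ups w - t - 1" "t - ups w"] exits_ups[OF that]
    by linarith
  then have "degree ?s \<le> 2 * K"
    by (intro degree_sum_le finite_exits finite_lessThan) auto
  then have less: "degree (- ?s) < degree (main_poly K)"
    by (simp add: degree_main_poly)
  have eq: "count_poly K = - ?s + main_poly K"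
    by (simp add: count_poly_def)
  show "degree (count_poly K) = 2 * K + 1"
    unfolding eq using less by (subst degree_add_eq_right) (simp_all add: degree_main_poly)
  show "lead_coeff (count_poly K) = 2 ^ (3 * K + 1)"
    unfolding eq lead_coeff_add_le[OF less] by (rule lead_coeff_main_poly)
qed

lemma count_poly_root: "poly (count_poly K) 0 = 0"
proof -
  have "gessel_walks m 0 (-1) = {}" for m
    using quadrant_walks_end by (fastforce simp: gessel_walks_eq quadrant_def)
  then show ?thesis
    using count_poly_eval[of 0 K] by (simp add: F_def)
qed

theorem mainTheorem7:
  fixes k :: nat
  assumes "k \<ge> 1"
  shows "\<exists>p :: int poly.
           degree p = 2 * k - 2 \<and> lead_coeff p = 2 ^ (3 * k - 2) \<and>
           (\<forall>n :: nat.
              (fact n * fact k * fact (n + k + 1) / fact (2 * n + 2) :: rat)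
                * of_nat (F (2 * n + 2 * k) 0 (int n))
              = of_int (poly p (int n)))"
proof -
  obtain K where k: "k = Suc K"
    using assms by (cases k) auto
  obtain r where r: "count_poly K = [:0, 1:] * r"
    using count_poly_root[of K] by (auto simp: poly_eq_0_iff_dvd elim: dvdE)
  have "r \<noteq> 0"
    using r degree_count_poly[of K] by auto
  then have deg: "degree r = 2 * K"
    using degree_count_poly[of K] unfolding r by (subst (asm) degree_mult_eq) auto
  have lead: "lead_coeff r = 2 ^ (3 * K + 1)"
    using lead_coeff_count_poly[of K] unfolding r lead_coeff_mult by simp
  \<comment> \<open>\<open>r\<close> is a polynomial in \<open>N = n + 1\<close>; the shift
    preserves degree and leading coefficient.\<close>
  define p where "p = pcompose r [:1, 1:]"
  have "degree p = 2 * k - 2"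
    by (simp add: p_def degree_pcompose deg k)
  moreover have "lead_coeff p = 2 ^ (3 * k - 2)"
    by (simp add: p_def lead_coeff_comp lead k)
  moreover have "(fact n * fact k * fact (n + k + 1) / fact (2 * n + 2) :: rat)
      * of_nat (F (2 * n + 2 * k) 0 (int n)) = of_int (poly p (int n))" for n
  proof -
    have "fact (Suc n) * fact k * fact (n + k + 1) * int (F (2 * n + 2 * k) 0 (int n))
        = fact (2 * n + 2) * (int (Suc n) * poly p (int n))"
      using count_poly_eval[of "Suc n" K]
      by (simp add: r k p_def poly_pcompose add_ac del: fact_Suc)
    then have "int (Suc n) * (fact n * fact k * fact (n + k + 1) * int (F (2 * n + 2 * k) 0 (int n)))
        = int (Suc n) * (fact (2 * n + 2) * poly p (int n))"
      by (simp only: fact_Suc of_nat_id mult_ac)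
    then have "fact n * fact k * fact (n + k + 1) * int (F (2 * n + 2 * k) 0 (int n))
        = fact (2 * n + 2) * poly p (int n)"
      by (simp only: mult_cancel_left of_nat_eq_0_iff) simp
    from arg_cong[OF this, of "of_int :: int \<Rightarrow> rat"] show ?thesis
      by (simp add: field_simps del: fact_Suc)
  qed
  ultimately show ?thesis
    by blast
qed

end
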